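(* Let $G=(V,E)$ be a finite simple connected graph with at least two vertices, with adjacency matrix $A$ and degree matrix $D$, and let $M=I-AD^{-1}$. Let $\phi_k\in\mathbb{R}^V$, $\phi_k\neq0$, be an eigenvector of $M$ with $M\phi_k=\lambda_k\phi_k$. Then $0\le\lambda_k\le2$ and $$W_1(\phi_k^+,\phi_k^-)\le\frac{1}{1-|1-\lambda_k|}\,\|\phi_k\|_{\ell^1},$$ where the right-hand side is interpreted as $+\infty$ when $\lambda_k\in\{0,2\}$.
   Context: $A$ is the matrix with $a_{xy}=1$ if $x,y$ are adjacent and $0$ otherwise; $D$ is the diagonal matrix of vertex degrees. Vectors in $\mathbb{R}^V$ are identified with functions on $V$ and with signed measures on $V$. $\phi^+=\max\{\phi,0\}$ and $\phi^-=\max\{-\phi,0\}$ (pointwise) are the positive and negative parts, so $\phi=\phi^+-\phi^-$, and $\|\phi\|_{\ell^1}=\sum_{x\in V}|\phi(x)|$. For nonnegative measures $\mu,\nu$ on $V$ (not necessarily probability measures), the Earth Mover's Distance is $$W_1(\mu,\nu)=\inf_{\gamma\in\Gamma(\mu,\nu)}\sum_{x,y\in V}d(x,y)\,\gamma(x,y),$$ where $d$ is the shortest-path distance in $G$ (each edge has length 1) and $\Gamma(\mu,\nu)$ is the set of nonnegative measures on $V\times V$ with marginals $\mu$ and $\nu$; the infimum over the empty set (when $\mu$ and $\nu$ have different total mass) is $+\infty$. *)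

theory Defs
  imports
    "Graph_Theory.Graph_Theory"
    "HOL-Analysis.Analysis"
begin

text \<open>
  The locale \<^locale>\<open>graph\<close> describes finite simple graphs as symmetric loop-free digraphs without
  parallel arcs, so an undirected edge is a pair of opposite arcs, and the degree of a vertex is
  its out-degree. The vertex set is the whole finite type \<open>'v\<close> (hypothesis
  \<open>verts G = UNIV\<close> wherever it matters), so that \<open>real ^ 'v\<close> and \<open>real ^ 'v ^ 'v\<close> are the
  vectors and matrices indexed by vertices.
\<close>

definition adjacency_matrix :: "('v::finite, 'e) pre_digraph \<Rightarrow> real ^ 'v ^ 'v" where
  "adjacency_matrix G = (\<chi> x y. if x \<rightarrow>\<^bsub>G\<^esub> y then 1 else 0)"

definition degree_matrix :: "('v::finite, 'e) pre_digraph \<Rightarrow> real ^ 'v ^ 'v" where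
  "degree_matrix G = (\<chi> x y. if x = y then real (out_degree G x) else 0)"

definition graph_laplacian :: "('v::finite, 'e) pre_digraph \<Rightarrow> real ^ 'v ^ 'v" where
  "graph_laplacian G = mat 1 - adjacency_matrix G ** matrix_inv (degree_matrix G)"

text \<open>Each arc has length 1. The value is \<open>\<infinity>\<close> if there is no walk.\<close>

definition graph_dist :: "('v, 'e) pre_digraph \<Rightarrow> 'v \<Rightarrow> 'v \<Rightarrow> ereal" where
  "graph_dist G x y = wf_digraph.\<mu> G (\<lambda>_. 1) x y"

definition positive_part :: "real ^ 'v \<Rightarrow> real ^ 'v" where
  "positive_part \<phi> = (\<chi> x. max (\<phi> $ x) 0)"

definition negative_part :: "real ^ 'v \<Rightarrow> real ^ 'v" where
  "negative_part \<phi> = (\<chi> x. max (- \<phi> $ x) 0)"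

definition l1_norm :: "real ^ 'v::finite \<Rightarrow> real" where
  "l1_norm \<phi> = (\<Sum>x\<in>UNIV. \<bar>\<phi> $ x\<bar>)"

definition couplings :: "real ^ 'v::finite \<Rightarrow> real ^ 'v \<Rightarrow> ('v \<Rightarrow> 'v \<Rightarrow> real) set" where
  "couplings \<mu> \<nu> = {\<gamma>. (\<forall>x y. \<gamma> x y \<ge> 0) \<and>
     (\<forall>x. (\<Sum>y\<in>UNIV. \<gamma> x y) = \<mu> $ x) \<and> (\<forall>y. (\<Sum>x\<in>UNIV. \<gamma> x y) = \<nu> $ y)}"

text \<open>In \<open>ereal\<close> the infimum of the empty set is \<open>\<infinity>\<close>.\<close>

definition earth_mover_dist ::
    "('v::finite, 'e) pre_digraph \<Rightarrow> real ^ 'v \<Rightarrow> real ^ 'v \<Rightarrow> ereal" where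
  "earth_mover_dist G \<mu> \<nu> =
     (INF \<gamma>\<in>couplings \<mu> \<nu>. \<Sum>x\<in>UNIV. \<Sum>y\<in>UNIV. graph_dist G x y * ereal (\<gamma> x y))"

end

theory Submission
  imports Defs
begin

text \<open>
  Put \<open>P = A D\<inverse>\<close>, the transition matrix of the simple random walk, whose columns sum to 1; the
  eigenvector equation says \<open>P \<phi> = (1 - \<lambda>) \<phi>\<close>. A column stochastic matrix does not increase the
  \<open>\<ell>\<^sup>1\<close> norm, so \<open>\<bar>1 - \<lambda>\<bar> \<le> 1\<close>, which is \<open>0 \<le> \<lambda> \<le> 2\<close>
  (\<open>column_stochastic_eigenvalue_bound\<close>).

  For the transport bound, let \<open>\<lambda> > 0\<close> and let the walk make a single step: send the mass
  \<open>\<phi>\<^sup>+\<close> forward along \<open>P\<close>, and pull the mass \<open>\<phi>\<^sup>-\<close> back along the same arcs. This plan moves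
  total mass \<open>\<parallel>\<phi>\<parallel>\<^sub>1\<close> over distance at most 1 (\<open>one_step_plan_cost\<close>), and its net outflow is
  \<open>\<phi> - P \<phi> = \<lambda> \<phi>\<close> (\<open>one_step_plan_divergence\<close>). Divided by \<open>\<lambda>\<close>, it is a plan with net
  outflow \<open>\<phi>\<close> and cost at most \<open>\<parallel>\<phi>\<parallel>\<^sub>1 / \<lambda>\<close>. Since \<open>1 - \<bar>1 - \<lambda>\<bar> \<le> \<lambda>\<close>, this is at most the
  claimed bound.

  What remains is that this plan need not be a coupling of \<open>\<phi>\<^sup>+\<close> and \<open>\<phi>\<^sup>-\<close>: its two marginals
  differ by \<open>\<phi>\<close> but may share some mass. Shared mass at a vertex \<open>z\<close> is removed by joining what
  is brought to \<open>z\<close> with what is taken away from \<open>z\<close> (\<open>reroute_through_vertex\<close>); the triangle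
  inequality makes this no more expensive. Doing so at every vertex leaves marginals with disjoint
  supports and difference \<open>\<phi>\<close>, and those can only be \<open>\<phi>\<^sup>+\<close> and \<open>\<phi>\<^sup>-\<close>
  (\<open>earth_mover_dist_le_cost_of_divergence\<close>).
\<close>

section \<open>Removing the common mass of two marginals\<close>

text \<open>
  A plan that brings mass \<open>r x\<close> from each \<open>x\<close> to \<open>z\<close> and takes \<open>s y\<close> from \<open>z\<close> to each \<open>y\<close> can
  send mass proportional to \<open>r x * s y\<close> from \<open>x\<close> directly to \<open>y\<close> instead. The factor
  \<open>1 / max inflow outflow\<close> is the one for which the smaller of the two streams at \<open>z\<close> is used up
  completely. The marginals at the other vertices do not change at all, which is what
  lets the vertices be treated one after the other.
\<close>

lemma reroute_through_vertex:
  fixes \<gamma> d :: "'v::finite \<Rightarrow> 'v \<Rightarrow> real"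
  assumes nonneg: "\<And>x y. 0 \<le> \<gamma> x y"
    and d_nonneg: "\<And>x y. 0 \<le> d x y"
    and triangle: "\<And>x y w. d x y \<le> d x w + d w y"
  obtains \<gamma>' where "\<And>x y. 0 \<le> \<gamma>' x y"
    and "\<And>x. x \<noteq> z \<Longrightarrow> (\<Sum>y\<in>UNIV. \<gamma>' x y) = (\<Sum>y\<in>UNIV. \<gamma> x y)"
    and "\<And>x. x \<noteq> z \<Longrightarrow> (\<Sum>y\<in>UNIV. \<gamma>' y x) = (\<Sum>y\<in>UNIV. \<gamma> y x)"
    and "(\<Sum>y\<in>UNIV. \<gamma>' z y) - (\<Sum>y\<in>UNIV. \<gamma>' y z) = (\<Sum>y\<in>UNIV. \<gamma> z y) - (\<Sum>y\<in>UNIV. \<gamma> y z)"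
    and "(\<Sum>y\<in>UNIV. \<gamma>' z y) = 0 \<or> (\<Sum>y\<in>UNIV. \<gamma>' y z) = 0"
    and "(\<Sum>x\<in>UNIV. \<Sum>y\<in>UNIV. d x y * \<gamma>' x y) \<le> (\<Sum>x\<in>UNIV. \<Sum>y\<in>UNIV. d x y * \<gamma> x y)"
proof -
  define r where "r x = (if x = z then 0 else \<gamma> x z)" for x
  define s where "s y = (if y = z then 0 else \<gamma> z y)" for y
  define \<beta> where "\<beta> x y = (if x = z \<or> y = z then 0 else \<gamma> x y)" for x y
  define inflow where "inflow = (\<Sum>x\<in>UNIV. r x)"
  define loop where "loop = \<gamma> z z"
  define outflow where "outflow = (\<Sum>y\<in>UNIV. s y)"
  \<comment> \<open>If both streams vanish, division by zero gives \<open>a = 0\<close>, and nothing is rerouted.\<close>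
  define a where "a = 1 / max inflow outflow"
  define \<gamma>' where "\<gamma>' x y = \<beta> x y + a * (r x * s y)
      + (if y = z then (1 - outflow * a) * r x else 0)
      + (if x = z then (1 - inflow * a) * s y else 0)" for x y
  have rs: "r x \<ge> 0" "s x \<ge> 0" "r z = 0" "s z = 0" "\<beta> x y \<ge> 0" "\<beta> z y = 0" "\<beta> x z = 0" for x y
    using nonneg by (auto simp: r_def s_def \<beta>_def loop_def)
  have flows: "inflow \<ge> 0" "outflow \<ge> 0"
    using rs by (auto simp: inflow_def outflow_def intro: sum_nonneg)
  have a: "a \<ge> 0" "inflow * a \<le> 1" "outflow * a \<le> 1"
    using flows by (auto simp: a_def divide_simps max_def)
  have \<gamma>: "\<gamma> x y = \<beta> x y + (if y = z then r x else 0) + (if x = z then s y else 0)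
      + (if x = z then (if y = z then loop else 0) else 0)" for x y
    by (auto simp: r_def s_def \<beta>_def loop_def)
  have row: "(\<Sum>y\<in>UNIV. \<gamma> x y) = (\<Sum>y\<in>UNIV. \<beta> x y) + r x
      + (if x = z then outflow + loop else 0)" for x
    by (subst \<gamma>) (simp add: sum.distrib outflow_def)
  have col: "(\<Sum>x\<in>UNIV. \<gamma> x y) = (\<Sum>x\<in>UNIV. \<beta> x y) + s y
      + (if y = z then inflow + loop else 0)" for y
    by (subst \<gamma>) (simp add: sum.distrib inflow_def)
  have row': "(\<Sum>y\<in>UNIV. \<gamma>' x y) = (\<Sum>y\<in>UNIV. \<beta> x y) + r x
      + (if x = z then (1 - inflow * a) * outflow else 0)" for x
  proof -
    have "(\<Sum>y\<in>UNIV. a * (r x * s y)) = a * outflow * r x"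
      by (simp add: outflow_def sum_distrib_left sum_distrib_right mult_ac)
    moreover have "(\<Sum>y\<in>UNIV. if x = z then (1 - inflow * a) * s y else 0)
        = (if x = z then (1 - inflow * a) * outflow else 0)"
      by (simp add: outflow_def sum_distrib_left)
    ultimately show ?thesis
      by (simp add: \<gamma>'_def sum.distrib algebra_simps)
  qed
  have col': "(\<Sum>x\<in>UNIV. \<gamma>' x y) = (\<Sum>x\<in>UNIV. \<beta> x y) + s y
      + (if y = z then (1 - outflow * a) * inflow else 0)" for y
  proof -
    have "(\<Sum>x\<in>UNIV. a * (r x * s y)) = a * inflow * s y"
      by (simp add: inflow_def sum_distrib_left sum_distrib_right mult_ac)
    moreover have "(\<Sum>x\<in>UNIV. if y = z then (1 - outflow * a) * r x else 0)
        = (if y = z then (1 - outflow * a) * inflow else 0)"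
      by (simp add: inflow_def sum_distrib_left)
    ultimately show ?thesis
      by (simp add: \<gamma>'_def sum.distrib algebra_simps)
  qed
  have zero: "(1 - inflow * a) * outflow = 0 \<or> (1 - outflow * a) * inflow = 0"
    using flows by (auto simp: a_def max_def)
  define cost where "cost = (\<Sum>x\<in>UNIV. \<Sum>y\<in>UNIV. d x y * \<beta> x y)"
  define cost_in where "cost_in = (\<Sum>x\<in>UNIV. d x z * r x)"
  define cost_out where "cost_out = (\<Sum>y\<in>UNIV. d z y * s y)"
  have cost_\<gamma>: "(\<Sum>x\<in>UNIV. \<Sum>y\<in>UNIV. d x y * \<gamma> x y) = cost + cost_in + cost_out + d z z * loop"
  proof -
    have "d x y * \<gamma> x y = d x y * \<beta> x y + (if y = z then d x y * r x else 0)
        + (if x = z then d x y * s y else 0)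
        + (if x = z then (if y = z then d z z * loop else 0) else 0)" for x y
      by (subst \<gamma>) (simp add: algebra_simps)
    moreover have "(\<Sum>x\<in>UNIV. \<Sum>y\<in>UNIV. if x = z then d x y * s y else 0) = cost_out"
      by (subst sum.swap) (simp add: cost_out_def)
    moreover have "(\<Sum>x\<in>UNIV. \<Sum>y\<in>UNIV. if x = z then (if y = z then d z z * loop else 0) else 0)
        = d z z * loop"
      by (subst sum.swap) simp
    ultimately show ?thesis
      by (simp add: sum.distrib cost_def cost_in_def)
  qed
  have cost_\<gamma>': "(\<Sum>x\<in>UNIV. \<Sum>y\<in>UNIV. d x y * \<gamma>' x y)
      = cost + a * (\<Sum>x\<in>UNIV. \<Sum>y\<in>UNIV. d x y * (r x * s y))
        + (1 - outflow * a) * cost_in + (1 - inflow * a) * cost_out"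
  proof -
    have "d x y * \<gamma>' x y = d x y * \<beta> x y + a * (d x y * (r x * s y))
        + (if y = z then (1 - outflow * a) * (d x y * r x) else 0)
        + (if x = z then (1 - inflow * a) * (d x y * s y) else 0)" for x y
      by (simp add: \<gamma>'_def algebra_simps)
    moreover have "(\<Sum>x\<in>UNIV. \<Sum>y\<in>UNIV. if x = z then (1 - inflow * a) * (d x y * s y) else 0)
        = (1 - inflow * a) * cost_out"
      by (subst sum.swap) (simp add: cost_out_def sum_distrib_left)
    ultimately show ?thesis
      by (simp add: sum.distrib cost_def cost_in_def sum_distrib_left)
  qed
  have "(\<Sum>x\<in>UNIV. \<Sum>y\<in>UNIV. d x y * (r x * s y))
      \<le> (\<Sum>x\<in>UNIV. \<Sum>y\<in>UNIV. (d x z * r x) * s y + r x * (d z y * s y))"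
  proof (intro sum_mono)
    fix x y
    have "d x y * (r x * s y) \<le> (d x z + d z y) * (r x * s y)"
      using rs triangle by (intro mult_right_mono) auto
    then show "d x y * (r x * s y) \<le> (d x z * r x) * s y + r x * (d z y * s y)"
      by (simp add: algebra_simps)
  qed
  also have "\<dots> = cost_in * outflow + inflow * cost_out"
    by (simp add: sum.distrib sum_product cost_in_def cost_out_def inflow_def outflow_def)
  finally have "a * (\<Sum>x\<in>UNIV. \<Sum>y\<in>UNIV. d x y * (r x * s y))
      \<le> a * (cost_in * outflow + inflow * cost_out)"
    using a by (intro mult_left_mono)
  moreover have "d z z * loop \<ge> 0"
    using nonneg d_nonneg by (simp add: loop_def)
  ultimately have cost_le: "(\<Sum>x\<in>UNIV. \<Sum>y\<in>UNIV. d x y * \<gamma>' x y) \<le> (\<Sum>x\<in>UNIV. \<Sum>y\<in>UNIV. d x y * \<gamma> x y)"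
    unfolding cost_\<gamma> cost_\<gamma>' by (simp add: algebra_simps)
  show thesis
  proof (rule that[of \<gamma>'])
    show "0 \<le> \<gamma>' x y" for x y
      using rs a by (auto simp: \<gamma>'_def)
  qed (use rs zero cost_le in \<open>auto simp: row col row' col' algebra_simps\<close>)
qed

lemma cancel_common_mass:
  fixes \<gamma> d :: "'v::finite \<Rightarrow> 'v \<Rightarrow> real"
  assumes nonneg: "\<And>x y. 0 \<le> \<gamma> x y"
    and d_nonneg: "\<And>x y. 0 \<le> d x y"
    and triangle: "\<And>x y w. d x y \<le> d x w + d w y"
  obtains \<gamma>' where "\<And>x y. 0 \<le> \<gamma>' x y"
    and "\<And>x. (\<Sum>y\<in>UNIV. \<gamma>' x y) - (\<Sum>y\<in>UNIV. \<gamma>' y x) = (\<Sum>y\<in>UNIV. \<gamma> x y) - (\<Sum>y\<in>UNIV. \<gamma> y x)"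
    and "\<And>x. (\<Sum>y\<in>UNIV. \<gamma>' x y) = 0 \<or> (\<Sum>y\<in>UNIV. \<gamma>' y x) = 0"
    and "(\<Sum>x\<in>UNIV. \<Sum>y\<in>UNIV. d x y * \<gamma>' x y) \<le> (\<Sum>x\<in>UNIV. \<Sum>y\<in>UNIV. d x y * \<gamma> x y)"
proof -
  have "\<exists>\<gamma>'. (\<forall>x y. 0 \<le> \<gamma>' x y)
      \<and> (\<forall>x. (\<Sum>y\<in>UNIV. \<gamma>' x y) - (\<Sum>y\<in>UNIV. \<gamma>' y x) = (\<Sum>y\<in>UNIV. \<gamma> x y) - (\<Sum>y\<in>UNIV. \<gamma> y x))
      \<and> (\<forall>x\<in>S. (\<Sum>y\<in>UNIV. \<gamma>' x y) = 0 \<or> (\<Sum>y\<in>UNIV. \<gamma>' y x) = 0)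
      \<and> (\<Sum>x\<in>UNIV. \<Sum>y\<in>UNIV. d x y * \<gamma>' x y) \<le> (\<Sum>x\<in>UNIV. \<Sum>y\<in>UNIV. d x y * \<gamma> x y)"
    for S :: "'v set"
  proof (induction S rule: finite_induct[OF finite])
    case 1
    show ?case
      using nonneg by (intro exI[of _ \<gamma>]) auto
  next
    case (2 z S)
    then obtain \<gamma>1 where 1: "\<forall>x y. 0 \<le> \<gamma>1 x y"
      "\<forall>x. (\<Sum>y\<in>UNIV. \<gamma>1 x y) - (\<Sum>y\<in>UNIV. \<gamma>1 y x) = (\<Sum>y\<in>UNIV. \<gamma> x y) - (\<Sum>y\<in>UNIV. \<gamma> y x)"
      "\<forall>x\<in>S. (\<Sum>y\<in>UNIV. \<gamma>1 x y) = 0 \<or> (\<Sum>y\<in>UNIV. \<gamma>1 y x) = 0"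
      "(\<Sum>x\<in>UNIV. \<Sum>y\<in>UNIV. d x y * \<gamma>1 x y) \<le> (\<Sum>x\<in>UNIV. \<Sum>y\<in>UNIV. d x y * \<gamma> x y)"
      by blast
    obtain \<gamma>2 where 2: "\<And>x y. 0 \<le> \<gamma>2 x y"
      "\<And>x. x \<noteq> z \<Longrightarrow> (\<Sum>y\<in>UNIV. \<gamma>2 x y) = (\<Sum>y\<in>UNIV. \<gamma>1 x y)"
      "\<And>x. x \<noteq> z \<Longrightarrow> (\<Sum>y\<in>UNIV. \<gamma>2 y x) = (\<Sum>y\<in>UNIV. \<gamma>1 y x)"
      "(\<Sum>y\<in>UNIV. \<gamma>2 z y) - (\<Sum>y\<in>UNIV. \<gamma>2 y z) = (\<Sum>y\<in>UNIV. \<gamma>1 z y) - (\<Sum>y\<in>UNIV. \<gamma>1 y z)"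
      "(\<Sum>y\<in>UNIV. \<gamma>2 z y) = 0 \<or> (\<Sum>y\<in>UNIV. \<gamma>2 y z) = 0"
      "(\<Sum>x\<in>UNIV. \<Sum>y\<in>UNIV. d x y * \<gamma>2 x y) \<le> (\<Sum>x\<in>UNIV. \<Sum>y\<in>UNIV. d x y * \<gamma>1 x y)"
      by (rule reroute_through_vertex[of \<gamma>1 d z]) (use 1(1) d_nonneg triangle in auto)
    show ?case
    proof (intro exI[of _ \<gamma>2] conjI allI ballI)
      show "0 \<le> \<gamma>2 x y" for x y by (rule 2)
      show "(\<Sum>y\<in>UNIV. \<gamma>2 x y) - (\<Sum>y\<in>UNIV. \<gamma>2 y x) = (\<Sum>y\<in>UNIV. \<gamma> x y) - (\<Sum>y\<in>UNIV. \<gamma> y x)" for x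
        using spec[OF 1(2), of x] 2(2,3)[of x] 2(4) by (cases "x = z") auto
      show "(\<Sum>y\<in>UNIV. \<gamma>2 x y) = 0 \<or> (\<Sum>y\<in>UNIV. \<gamma>2 y x) = 0" if "x \<in> insert z S" for x
        using 1(3) 2(2,3)[of x] 2(5) that by (cases "x = z") auto
      show "(\<Sum>x\<in>UNIV. \<Sum>y\<in>UNIV. d x y * \<gamma>2 x y) \<le> (\<Sum>x\<in>UNIV. \<Sum>y\<in>UNIV. d x y * \<gamma> x y)"
        using 1(4) 2(6) by linarith
    qed
  qed
  from this[of UNIV] show thesis
    using that by blast
qed

text \<open>
  The Earth Mover's Distance of the two parts of \<open>\<phi>\<close> is bounded by the cost of any flow with
  divergence \<open>\<phi>\<close>, because a decomposition of \<open>\<phi>\<close> as a difference of nonnegative functions with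
  disjoint supports is unique. This frees the construction of plans from the exact marginals.
\<close>

lemma earth_mover_dist_le_cost_of_divergence:
  fixes G :: "('v::finite, 'e) pre_digraph" and \<phi> :: "real ^ 'v"
  assumes dist: "\<And>x y. graph_dist G x y = ereal (d x y)"
    and d_nonneg: "\<And>x y. 0 \<le> d x y"
    and triangle: "\<And>x y w. d x y \<le> d x w + d w y"
    and nonneg: "\<And>x y. 0 \<le> \<gamma> x y"
    and divergence: "\<And>x. (\<Sum>y\<in>UNIV. \<gamma> x y) - (\<Sum>y\<in>UNIV. \<gamma> y x) = \<phi> $ x"
  shows "earth_mover_dist G (positive_part \<phi>) (negative_part \<phi>)
      \<le> ereal (\<Sum>x\<in>UNIV. \<Sum>y\<in>UNIV. d x y * \<gamma> x y)"
proof -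
  obtain \<gamma>' where \<gamma>': "\<And>x y. 0 \<le> \<gamma>' x y"
    "\<And>x. (\<Sum>y\<in>UNIV. \<gamma>' x y) - (\<Sum>y\<in>UNIV. \<gamma>' y x) = (\<Sum>y\<in>UNIV. \<gamma> x y) - (\<Sum>y\<in>UNIV. \<gamma> y x)"
    "\<And>x. (\<Sum>y\<in>UNIV. \<gamma>' x y) = 0 \<or> (\<Sum>y\<in>UNIV. \<gamma>' y x) = 0"
    "(\<Sum>x\<in>UNIV. \<Sum>y\<in>UNIV. d x y * \<gamma>' x y) \<le> (\<Sum>x\<in>UNIV. \<Sum>y\<in>UNIV. d x y * \<gamma> x y)"
    by (rule cancel_common_mass[OF nonneg d_nonneg triangle]) (rule that)
  have "(\<Sum>y\<in>UNIV. \<gamma>' x y) = max (\<phi> $ x) 0 \<and> (\<Sum>y\<in>UNIV. \<gamma>' y x) = max (- \<phi> $ x) 0" for x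
  proof -
    have "(\<Sum>y\<in>UNIV. \<gamma>' x y) \<ge> 0" "(\<Sum>y\<in>UNIV. \<gamma>' y x) \<ge> 0"
      using \<gamma>'(1) by (auto intro: sum_nonneg)
    moreover have "(\<Sum>y\<in>UNIV. \<gamma>' x y) - (\<Sum>y\<in>UNIV. \<gamma>' y x) = \<phi> $ x"
      by (simp only: \<gamma>'(2) divergence)
    ultimately show ?thesis
      using \<gamma>'(3)[of x] by (elim disjE) (simp_all add: max_def)
  qed
  then have "\<gamma>' \<in> couplings (positive_part \<phi>) (negative_part \<phi>)"
    using \<gamma>'(1) by (simp add: couplings_def positive_part_def negative_part_def)
  then have "earth_mover_dist G (positive_part \<phi>) (negative_part \<phi>)
      \<le> (\<Sum>x\<in>UNIV. \<Sum>y\<in>UNIV. graph_dist G x y * ereal (\<gamma>' x y))"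
    unfolding earth_mover_dist_def by (rule INF_lower)
  also have "\<dots> = ereal (\<Sum>x\<in>UNIV. \<Sum>y\<in>UNIV. d x y * \<gamma>' x y)"
    by (simp add: dist)
  finally show ?thesis
    using \<gamma>'(4) by (meson ereal_less_eq(3) order_trans)
qed

section \<open>Distances and degrees in a connected graph\<close>

text \<open>
  Shortest walks exist between any two vertices, so that the extended real distance is represented
  by a real function, on which sums and products are those of real arithmetic.
\<close>

lemma connected_graph_dist_metric:
  fixes G :: "('v, 'e) pre_digraph"
  assumes "graph G" and UNIV: "verts G = UNIV" and "Digraph_Component.connected G"
  obtains d :: "'v \<Rightarrow> 'v \<Rightarrow> real" where "\<And>x y. graph_dist G x y = ereal (d x y)"
    and "\<And>x y. 0 \<le> d x y" and "\<And>x y w. d x y \<le> d x w + d w y"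
    and "\<And>x y. x \<rightarrow>\<^bsub>G\<^esub> y \<Longrightarrow> d x y \<le> 1"
proof -
  interpret graph G by fact
  have reach: "x \<rightarrow>\<^sup>*\<^bsub>G\<^esub> y" for x y
    using symmetric_connected_imp_strongly_connected[OF sym_arcs assms(3)] UNIV by auto
  have "\<exists>p. awalk x p y \<and> \<mu> (\<lambda>_. 1) x y = awalk_cost (\<lambda>_. 1) p" for x y
    using min_cost_awalk[OF reach, of "\<lambda>_. 1" x y] by (auto dest: awalkI_apath)
  then obtain p where p: "\<And>x y. awalk x (p x y) y"
      "\<And>x y. \<mu> (\<lambda>_. 1) x y = awalk_cost (\<lambda>_. 1) (p x y)"
    by metis
  have le: "awalk_cost (\<lambda>_. 1) (p x y) \<le> awalk_cost (\<lambda>_. 1) q" if "awalk x q y" for x y q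
    using min_cost_le_walk_cost[OF that, of "\<lambda>_. 1"] by (simp add: p)
  show thesis
  proof (rule that[of "\<lambda>x y. awalk_cost (\<lambda>_. 1) (p x y)"])
    show "graph_dist G x y = ereal (awalk_cost (\<lambda>_. 1) (p x y))" for x y
      by (simp add: graph_dist_def p)
    show "0 \<le> awalk_cost (\<lambda>_. 1) (p x y)" for x y
      by (rule pos_cost_pos_awalk_cost[OF p(1)]) simp
    show "awalk_cost (\<lambda>_. 1) (p x y) \<le> awalk_cost (\<lambda>_. 1) (p x w) + awalk_cost (\<lambda>_. 1) (p w y)" for x y w
      using le[OF awalk_appendI[OF p(1)[of x w] p(1)[of w y]]] by simp
    show "awalk_cost (\<lambda>_. 1) (p x y) \<le> 1" if xy: "x \<rightarrow>\<^bsub>G\<^esub> y" for x y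
    proof -
      from xy obtain e where e: "e \<in> arcs G" "tail G e = x" "head G e = y"
        by (rule reachableE)
      then have "awalk x [e] y"
        using UNIV by (auto simp: awalk_Cons_iff awalk_Nil_iff)
      from le[OF this] show ?thesis by simp
    qed
  qed
qed

lemma out_degree_eq_card_successors:
  fixes G :: "('v, 'e) pre_digraph"
  assumes "nomulti_digraph G"
  shows "out_degree G x = card {y. x \<rightarrow>\<^bsub>G\<^esub> y}"
proof -
  interpret nomulti_digraph G by fact
  have "inj_on (head G) (out_arcs G x)"
    by (auto simp: inj_on_def arc_to_ends_def intro!: no_multi_arcs)
  moreover have "head G ` out_arcs G x = {y. x \<rightarrow>\<^bsub>G\<^esub> y}"
    by (auto simp: arcs_ends_conv)
  ultimately show ?thesis
    unfolding out_degree_def by (metis card_image)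
qed

text \<open>
  Positive degrees make the degree matrix invertible; without this its \<^const>\<open>matrix_inv\<close> would be
  an unspecified matrix.
\<close>

lemma connected_out_degree_pos:
  fixes G :: "('v::finite, 'e) pre_digraph"
  assumes "graph G" and UNIV: "verts G = UNIV" and "Digraph_Component.connected G"
    and "CARD('v) \<ge> 2"
  shows "out_degree G x > 0"
proof -
  interpret graph G by fact
  obtain y where "y \<noteq> x"
    using assms(4) by (metis card_2_iff' ex_card UNIV_I subsetD subset_UNIV)
  moreover have "x \<rightarrow>\<^sup>*\<^bsub>G\<^esub> y"
    using symmetric_connected_imp_strongly_connected[OF sym_arcs assms(3)] UNIV by auto
  ultimately obtain w where "x \<rightarrow>\<^bsub>G\<^esub> w"
    by (metis converse_reachable_cases)
  then have "{y. x \<rightarrow>\<^bsub>G\<^esub> y} \<noteq> {}" by auto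
  then show ?thesis
    using out_degree_eq_card_successors[OF nomulti_digraph, of x]
    by (simp add: card_gt_0_iff)
qed

section \<open>The normalized Laplacian and the random walk\<close>

lemma matrix_inv_unique:
  fixes A B :: "real ^ 'n::finite ^ 'n"
  assumes "A ** B = mat 1"
  shows "matrix_inv A = B"
proof -
  have BA: "B ** A = mat 1"
    using assms by (simp add: matrix_left_right_inverse)
  have "\<exists>A'. A ** A' = mat 1 \<and> A' ** A = mat 1"
    using assms BA by blast
  then have "A ** matrix_inv A = mat 1"
    unfolding matrix_inv_def by (rule someI2_ex) simp
  then show ?thesis
    by (metis BA matrix_mul_assoc matrix_mul_lid matrix_mul_rid)
qed

lemma matrix_inv_degree_matrix:
  fixes G :: "('v::finite, 'e) pre_digraph"
  assumes "\<And>x. out_degree G x > 0"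
  shows "matrix_inv (degree_matrix G) = (\<chi> x y. if x = y then 1 / real (out_degree G x) else 0)"
proof (rule matrix_inv_unique)
  let ?E = "\<chi> x y. if x = y then 1 / real (out_degree G x) else 0"
  have "(degree_matrix G ** ?E) $ x $ y = mat 1 $ x $ y" for x y
  proof -
    have "(degree_matrix G ** ?E) $ x $ y
        = (\<Sum>w\<in>UNIV. if w = y then (if x = y then 1 else 0) else 0)"
      unfolding matrix_matrix_mult_def degree_matrix_def vec_lambda_beta
      using assms[of y] by (intro sum.cong) auto
    then show ?thesis by (simp add: mat_def)
  qed
  then show "degree_matrix G ** ?E = mat 1"
    by (simp add: vec_eq_iff)
qed

text \<open>The weights in the sum are the entries of the transition matrix of the random walk.\<close>

lemma graph_laplacian_mult:
  fixes G :: "('v::finite, 'e) pre_digraph"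
  assumes "\<And>x. out_degree G x > 0"
  shows "(graph_laplacian G *v \<phi>) $ x
      = \<phi> $ x - (\<Sum>y\<in>UNIV. (if x \<rightarrow>\<^bsub>G\<^esub> y then 1 / real (out_degree G y) else 0) * \<phi> $ y)"
proof -
  have "(adjacency_matrix G ** matrix_inv (degree_matrix G)) $ x $ y
      = (if x \<rightarrow>\<^bsub>G\<^esub> y then 1 / real (out_degree G y) else 0)" for y
  proof -
    have "(adjacency_matrix G ** matrix_inv (degree_matrix G)) $ x $ y
        = (\<Sum>w\<in>UNIV. if w = y then (if x \<rightarrow>\<^bsub>G\<^esub> y then 1 / real (out_degree G y) else 0) else 0)"
      unfolding matrix_inv_degree_matrix[OF assms] matrix_matrix_mult_def adjacency_matrix_def
        vec_lambda_beta
      by (intro sum.cong) auto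
    then show ?thesis by simp
  qed
  then show ?thesis
    by (simp add: graph_laplacian_def matrix_vector_mult_diff_rdistrib)
       (simp add: matrix_vector_mult_def)
qed

text \<open>
  Summing \<open>\<bar>c\<bar> * \<bar>\<phi> x\<bar> \<le> (\<Sum>y. p x y * \<bar>\<phi> y\<bar>)\<close> over \<open>x\<close> gives \<open>\<bar>c\<bar> * \<parallel>\<phi>\<parallel>\<^sub>1 \<le> \<parallel>\<phi>\<parallel>\<^sub>1\<close>, as each
  column of \<open>p\<close> has sum 1.
\<close>

lemma column_stochastic_eigenvalue_bound:
  fixes p :: "'v::finite \<Rightarrow> 'v \<Rightarrow> real" and \<phi> :: "'v \<Rightarrow> real"
  assumes nonneg: "\<And>x y. 0 \<le> p x y" and stochastic: "\<And>y. (\<Sum>x\<in>UNIV. p x y) = 1"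
    and eigen: "\<And>x. (\<Sum>y\<in>UNIV. p x y * \<phi> y) = c * \<phi> x" and nonzero: "\<phi> v \<noteq> 0"
  shows "\<bar>c\<bar> \<le> 1"
proof -
  have "\<bar>c\<bar> * (\<Sum>x\<in>UNIV. \<bar>\<phi> x\<bar>) = (\<Sum>x\<in>UNIV. \<bar>\<Sum>y\<in>UNIV. p x y * \<phi> y\<bar>)"
    by (simp add: eigen abs_mult sum_distrib_left)
  also have "\<dots> \<le> (\<Sum>x\<in>UNIV. \<Sum>y\<in>UNIV. p x y * \<bar>\<phi> y\<bar>)"
    by (intro sum_mono order_trans[OF sum_abs]) (simp add: abs_mult nonneg)
  also have "\<dots> = (\<Sum>y\<in>UNIV. (\<Sum>x\<in>UNIV. p x y) * \<bar>\<phi> y\<bar>)"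
    by (subst sum.swap) (simp add: sum_distrib_right)
  finally have "\<bar>c\<bar> * (\<Sum>x\<in>UNIV. \<bar>\<phi> x\<bar>) \<le> 1 * (\<Sum>x\<in>UNIV. \<bar>\<phi> x\<bar>)"
    by (simp add: stochastic)
  moreover have "(\<Sum>x\<in>UNIV. \<bar>\<phi> x\<bar>) > 0"
    using nonzero by (intro sum_pos2[of _ v]) auto
  ultimately show ?thesis
    by (simp only: mult_le_cancel_right_pos)
qed

section \<open>Transport by one step of the walk\<close>

text \<open>
  The plan \<open>\<pi>\<close> has the marginals \<open>\<phi>\<^sup>+ + P \<phi>\<^sup>-\<close> and \<open>P \<phi>\<^sup>+ + \<phi>\<^sup>-\<close>, whose difference is linear
  in \<open>\<phi>\<close> although \<open>\<phi>\<^sup>+\<close> and \<open>\<phi>\<^sup>-\<close> are not.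
\<close>

lemma one_step_plan_divergence:
  fixes p :: "'v::finite \<Rightarrow> 'v \<Rightarrow> real" and \<phi> :: "real ^ 'v"
  assumes stochastic: "\<And>y. (\<Sum>x\<in>UNIV. p x y) = 1"
  defines "\<pi> \<equiv> \<lambda>x y. positive_part \<phi> $ x * p y x + negative_part \<phi> $ y * p x y"
  shows "(\<Sum>y\<in>UNIV. \<pi> x y) - (\<Sum>y\<in>UNIV. \<pi> y x) = \<phi> $ x - (\<Sum>y\<in>UNIV. p x y * \<phi> $ y)"
proof -
  have parts: "\<phi> $ y = positive_part \<phi> $ y - negative_part \<phi> $ y" for y
    by (simp add: positive_part_def negative_part_def)
  have "(\<Sum>y\<in>UNIV. \<pi> x y) = positive_part \<phi> $ x + (\<Sum>y\<in>UNIV. negative_part \<phi> $ y * p x y)"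
    by (simp add: \<pi>_def sum.distrib stochastic flip: sum_distrib_left)
  moreover have "(\<Sum>y\<in>UNIV. \<pi> y x) = (\<Sum>y\<in>UNIV. positive_part \<phi> $ y * p x y) + negative_part \<phi> $ x"
    by (simp add: \<pi>_def sum.distrib stochastic flip: sum_distrib_left)
  ultimately show ?thesis
    by (subst (1 2) parts) (simp add: algebra_simps sum_subtractf)
qed

text \<open>
  All mass of \<open>\<pi>\<close> travels between pairs that a step of the walk joins in one direction or the
  other, and the total mass of \<open>\<pi>\<close> is that of \<open>\<phi>\<^sup>+ + \<phi>\<^sup>-\<close>.
\<close>

lemma one_step_plan_cost:
  fixes p d :: "'v::finite \<Rightarrow> 'v \<Rightarrow> real" and \<phi> :: "real ^ 'v"
  assumes nonneg: "\<And>x y. 0 \<le> p x y" and stochastic: "\<And>y. (\<Sum>x\<in>UNIV. p x y) = 1"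
    and unit: "\<And>x y. p y x \<noteq> 0 \<or> p x y \<noteq> 0 \<Longrightarrow> d x y \<le> 1"
  defines "\<pi> \<equiv> \<lambda>x y. positive_part \<phi> $ x * p y x + negative_part \<phi> $ y * p x y"
  shows "(\<Sum>x\<in>UNIV. \<Sum>y\<in>UNIV. d x y * \<pi> x y) \<le> l1_norm \<phi>"
proof -
  have "d x y * \<pi> x y \<le> 1 * \<pi> x y" for x y
  proof (cases "p y x \<noteq> 0 \<or> p x y \<noteq> 0")
    case True
    then show ?thesis
      using unit nonneg
      by (intro mult_right_mono) (auto simp: \<pi>_def positive_part_def negative_part_def)
  qed (simp add: \<pi>_def)
  then have "(\<Sum>x\<in>UNIV. \<Sum>y\<in>UNIV. d x y * \<pi> x y) \<le> (\<Sum>x\<in>UNIV. \<Sum>y\<in>UNIV. \<pi> x y)"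
    by (intro sum_mono) simp
  also have "\<dots> = (\<Sum>x\<in>UNIV. \<Sum>y\<in>UNIV. positive_part \<phi> $ x * p y x)
      + (\<Sum>y\<in>UNIV. \<Sum>x\<in>UNIV. negative_part \<phi> $ y * p x y)"
    by (subst (3) sum.swap) (simp add: \<pi>_def sum.distrib)
  also have "\<dots> = (\<Sum>x\<in>UNIV. positive_part \<phi> $ x + negative_part \<phi> $ x)"
    by (simp add: sum.distrib stochastic flip: sum_distrib_left)
  also have "\<dots> = l1_norm \<phi>"
    unfolding l1_norm_def positive_part_def negative_part_def by (intro sum.cong) auto
  finally show ?thesis .
qed

theorem theorem2:
  fixes G :: "('v::finite, 'e) pre_digraph"
    and \<phi> :: "real ^ 'v"
    and l :: real
  assumes "graph G"
    and "verts G = UNIV"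
    and "Digraph_Component.connected G"
    and "CARD('v) \<ge> 2"
    and "\<phi> \<noteq> 0"
    and "graph_laplacian G *v \<phi> = l *\<^sub>R \<phi>"
  shows "0 \<le> l \<and> l \<le> 2 \<and>
    earth_mover_dist G (positive_part \<phi>) (negative_part \<phi>)
      \<le> (if l \<in> {0, 2} then \<infinity> else ereal (1 / (1 - \<bar>1 - l\<bar>) * l1_norm \<phi>))"
proof -
  interpret graph G by fact
  define p :: "'v \<Rightarrow> 'v \<Rightarrow> real"
    where "p x y = (if x \<rightarrow>\<^bsub>G\<^esub> y then 1 / real (out_degree G y) else 0)" for x y
  have deg: "out_degree G x > 0" for x
    by (rule connected_out_degree_pos) fact+
  have sym: "x \<rightarrow>\<^bsub>G\<^esub> y \<longleftrightarrow> y \<rightarrow>\<^bsub>G\<^esub> x" for x y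
    using arcs_ends_symmetric[OF sym_arcs] by blast
  have nonneg: "p x y \<ge> 0" for x y
    by (simp add: p_def)
  have stochastic: "(\<Sum>x\<in>UNIV. p x y) = 1" for y
  proof -
    have "(\<Sum>x\<in>UNIV. p x y) = real (card {x. y \<rightarrow>\<^bsub>G\<^esub> x}) / real (out_degree G y)"
      by (simp add: p_def sym[of _ y] sum.If_cases)
    then show ?thesis
      using deg[of y] by (simp flip: out_degree_eq_card_successors[OF nomulti_digraph])
  qed
  have eigen: "\<phi> $ x - (\<Sum>y\<in>UNIV. p x y * \<phi> $ y) = l * \<phi> $ x" for x
    using graph_laplacian_mult[OF deg, of \<phi> x] assms(6) by (simp add: p_def)
  obtain v where "\<phi> $ v \<noteq> 0"
    using assms(5) by (auto simp: vec_eq_iff)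
  moreover have "(\<Sum>y\<in>UNIV. p x y * \<phi> $ y) = (1 - l) * \<phi> $ x" for x
    using eigen[of x] by (simp add: algebra_simps)
  ultimately have "\<bar>1 - l\<bar> \<le> 1"
    using nonneg stochastic
    by (intro column_stochastic_eigenvalue_bound[where p = p and \<phi> = "($) \<phi>"])
  then have l: "0 \<le> l" "l \<le> 2"
    by auto
  moreover have "earth_mover_dist G (positive_part \<phi>) (negative_part \<phi>)
      \<le> ereal (1 / (1 - \<bar>1 - l\<bar>) * l1_norm \<phi>)" if "l \<noteq> 0" "l \<noteq> 2"
  proof -
    have "l > 0" "l < 2"
      using l that by auto
    obtain d where d: "\<And>x y. graph_dist G x y = ereal (d x y)" "\<And>x y. 0 \<le> d x y"
      "\<And>x y w. d x y \<le> d x w + d w y" "\<And>x y. x \<rightarrow>\<^bsub>G\<^esub> y \<Longrightarrow> d x y \<le> 1"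
      by (rule connected_graph_dist_metric[OF assms(1-3)]) (rule that)
    define \<pi> where "\<pi> x y = positive_part \<phi> $ x * p y x + negative_part \<phi> $ y * p x y" for x y
    have "0 \<le> \<pi> x y / l" for x y
      using \<open>l > 0\<close> nonneg by (simp add: \<pi>_def positive_part_def negative_part_def)
    moreover have "(\<Sum>y\<in>UNIV. \<pi> x y / l) - (\<Sum>y\<in>UNIV. \<pi> y x / l) = \<phi> $ x" for x
      using one_step_plan_divergence[where p = p, OF stochastic, of \<phi> x] eigen[of x] \<open>l > 0\<close>
      by (simp add: \<pi>_def flip: sum_divide_distrib diff_divide_distrib)
    ultimately have "earth_mover_dist G (positive_part \<phi>) (negative_part \<phi>)
        \<le> ereal (\<Sum>x\<in>UNIV. \<Sum>y\<in>UNIV. d x y * (\<pi> x y / l))"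
      by (intro earth_mover_dist_le_cost_of_divergence d)
    also have "(\<Sum>x\<in>UNIV. \<Sum>y\<in>UNIV. d x y * (\<pi> x y / l))
        = (\<Sum>x\<in>UNIV. \<Sum>y\<in>UNIV. d x y * \<pi> x y) / l"
      by (simp add: sum_divide_distrib)
    also have "\<dots> \<le> l1_norm \<phi> / l"
    proof (rule divide_right_mono)
      show "(\<Sum>x\<in>UNIV. \<Sum>y\<in>UNIV. d x y * \<pi> x y) \<le> l1_norm \<phi>"
        unfolding \<pi>_def
      proof (rule one_step_plan_cost[where p = p, OF nonneg stochastic])
        show "d x y \<le> 1" if "p y x \<noteq> 0 \<or> p x y \<noteq> 0" for x y
        proof (rule d(4))
          show "x \<rightarrow>\<^bsub>G\<^esub> y"
            using that sym[of x y] unfolding p_def by presburger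
        qed
      qed
    qed (use l in simp)
    \<comment> \<open>The two denominators agree for \<open>l \<le> 1\<close>; for \<open>l > 1\<close> the new one is \<open>2 - l < l\<close>.\<close>
    also have "\<dots> \<le> l1_norm \<phi> / (1 - \<bar>1 - l\<bar>)"
      using \<open>l > 0\<close> \<open>l < 2\<close> by (intro divide_left_mono) (auto simp: l1_norm_def sum_nonneg)
    finally show ?thesis
      by simp
  qed
  ultimately show ?thesis
    by auto
qed

end
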